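(* Consider the power allocation game described in the context, under its assumptions, with $\mathbf{G}_k$ fully controllable for each company $k$ (that is, company $k$ may choose any allocation $G_k(t)\ge 0$, $t\in\mathcal{T}$, with $\sum_{t\in\mathcal{T}}G_k(t)\le G_k^{\mathrm{total}}$). Then there exists a unique pure-strategy Nash equilibrium for the power allocation game, and it is given by $$G_k^*(t)=\frac{G_k^{\mathrm{total}}}{T},\qquad \forall\, t\in\mathcal{T},\ \forall\, k\in\mathcal{K}.$$
   Context: $\mathcal{K}=\{1,\dots,K\}$ is the set of companies, $\mathcal{N}=\{1,\dots,N\}$ the set of consumers, $\mathcal{T}=\{1,\dots,T\}$ the set of time slots. Consumer $n$ has budget $B_n\ge 0$, minimum energy need $E_n^{\min}\ge0$, and logarithmic utility $\gamma_n\sum_{k,t}\ln(\zeta_n+d_{n,k}(t))$ with $\gamma_n=\zeta_n=1$; $B=\sum_{n\in\mathcal{N}}B_n>0$. Company $k$ has total capacity $G_k^{\mathrm{total}}>0$ for the whole horizon. Budget assumption: for each $n$, $$B_n\ge \frac{E_n^{\min}+KT}{\sum_{k,t}\frac{1}{KTp_k(t)}}-\sum_{k,t}p_k(t)$$ for the announced prices $p_k(t)$. Power allocation game: given the allocations $\mathbf{G}_{-k}$ of the other companies, company $k$ chooses $\mathbf{G}_k=(G_k(t))_{t\in\mathcal{T}}$ to maximize $$\pi_k(\mathbf{G}_k,\mathbf{G}_{-k})=B\sum_{t\in\mathcal{T}}\frac{G_k(t)}{(G_k(t)+N)\left(KT-\sum_{j\in\mathcal{K}}\sum_{h\in\mathcal{T}}\frac{N}{G_j(h)+N}\right)}$$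 subject to $\sum_{t\in\mathcal{T}}G_k(t)\le G_k^{\mathrm{total}}$ and $G_k(t)\ge 0$ for all $t\in\mathcal{T}$. (This is the revenue $\sum_t p^*_k(t)G_k(t)$ at the prices $p_k^*(t)=\frac{B}{G_k(t)+N}\bigl(KT-\sum_{j,h}\frac{N}{G_j(h)+N}\bigr)^{-1}$.) A pure-strategy Nash equilibrium is a profile of feasible allocations from which no company can increase its $\pi_k$ by a unilateral feasible deviation.
   Formalization: Uniqueness is claimed only for at least two companies (K ≥ 2), since with K = 1 every nonzero feasible allocation earns exactly B and is an equilibrium; at the all-zero profile, where the payoff is 0/0, revenue is taken to be 0. *)

theory Defs
  imports Complex_Main "HOL-Library.Cardinality"
begin

text \<open>
  Companies, consumers and time slots are indexed by finite types \<open>'k\<close>, \<open>'n\<close>, \<open>'t\<close>, so that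
  \<open>K = CARD('k)\<close>, \<open>N = CARD('n)\<close> and \<open>T = CARD('t)\<close>.
\<close>

definition pure_nash_equilibrium ::
  "('k \<Rightarrow> 's set) \<Rightarrow> ('k \<Rightarrow> ('k \<Rightarrow> 's) \<Rightarrow> real) \<Rightarrow> ('k \<Rightarrow> 's) \<Rightarrow> bool" where
  "pure_nash_equilibrium S u s \<longleftrightarrow>
     (\<forall>k. s k \<in> S k) \<and> (\<forall>k. \<forall>s'\<in>S k. u k (s(k := s')) \<le> u k s)"

definition feasible_allocations :: "('k \<Rightarrow> real) \<Rightarrow> 'k \<Rightarrow> ('t::finite \<Rightarrow> real) set" where
  "feasible_allocations Gtotal k = {g. (\<Sum>t\<in>UNIV. g t) \<le> Gtotal k \<and> (\<forall>t. 0 \<le> g t)}"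

text \<open>
  The denominator vanishes on feasible profiles exactly when every allocation is zero; there
  \<open>x / 0 = 0\<close> assigns revenue 0 to every company, which then sells no power.
\<close>

definition revenue ::
  "('n::finite \<Rightarrow> real) \<Rightarrow> 'k::finite \<Rightarrow> ('k \<Rightarrow> 't::finite \<Rightarrow> real) \<Rightarrow> real" where
  "revenue budget k G =
     (\<Sum>n\<in>UNIV. budget n) *
     (\<Sum>t\<in>UNIV. G k t /
        ((G k t + real CARD('n)) *
         (real CARD('k) * real CARD('t)
            - (\<Sum>j\<in>UNIV. \<Sum>h\<in>UNIV. real CARD('n) / (G j h + real CARD('n))))))"

definition budgets_sufficient ::
  "('n \<Rightarrow> real) \<Rightarrow> ('n \<Rightarrow> real) \<Rightarrow> ('k::finite \<Rightarrow> 't::finite \<Rightarrow> real) \<Rightarrow> bool" where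
  "budgets_sufficient budget Emin p \<longleftrightarrow>
     (\<forall>n. budget n \<ge>
        (Emin n + real CARD('k) * real CARD('t)) /
          (\<Sum>k\<in>UNIV. \<Sum>t\<in>UNIV. 1 / (real CARD('k) * real CARD('t) * p k t))
        - (\<Sum>k\<in>UNIV. \<Sum>t\<in>UNIV. p k t))"

end

theory Submission
  imports Defs
begin

text \<open>
  Since \<open>1 - N / (g + N) = g / (g + N)\<close>, the denominator of the revenue is the sum over all
  companies of the same quantity that stands in its numerator. With the score
  \<open>X\<^sub>k = (\<Sum>t. G\<^sub>k t / (G\<^sub>k t + N))\<close>, the revenue of company \<open>k\<close> is therefore its
  proportional share \<open>B * X\<^sub>k / (\<Sum>j. X\<^sub>j)\<close> of the total budget (\<open>revenue_eq_share\<close>), and the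
  other companies influence it only through the sum of their scores.

  A share \<open>x / (x + r)\<close> increases with \<open>x\<close>, so company \<open>k\<close> should maximise its own score,
  whatever the others do. The function \<open>g / (g + N)\<close> is strictly concave and strictly increasing,
  so under the capacity constraint the score has the even split as its only maximiser
  (\<open>score_le_even_split\<close>, \<open>score_even_split_unique\<close>). Hence the even split is a dominant strategy,
  which gives existence.

  For uniqueness, strict monotonicity of the share needs \<open>r > 0\<close>: a company facing a rival with
  positive score must play the even split. In an equilibrium with at least two companies, every
  company has such a rival. If all scores were zero, any company could seize the
  whole budget with a nonzero allocation. If only one company had a positive score, each of the
  others would face a positive rival and so would play the even split, which has positive score.

  A single company receives the whole budget with every nonzero allocation, so uniqueness
  needs a second company.
\<close>

section \<open>The score of an allocation\<close>

definition score :: "real \<Rightarrow> ('t::finite \<Rightarrow> real) \<Rightarrow> real" where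
  "score c g = (\<Sum>t\<in>UNIV. g t / (g t + c))"

lemma score_nonneg:
  assumes "c > 0" "\<And>t. 0 \<le> g t"
  shows "0 \<le> score c g"
  unfolding score_def using assms by (intro sum_nonneg) (simp add: add_nonneg_nonneg)

lemma score_const: "score c (\<lambda>t::'t::finite. m) = real CARD('t) * (m / (m + c))"
  by (simp add: score_def)

text \<open>
  This is strict concavity of \<open>g / (g + c)\<close> in exact form: the defect between the function and its
  tangent at \<open>m\<close> is an explicit square.
\<close>

lemma tangent_at_even_split:
  fixes c m g :: real
  assumes "c > 0" "m \<ge> 0" "g \<ge> 0"
  shows "g / (g + c) = m / (m + c) + c / (m + c)\<^sup>2 * (g - m)
           - c * (g - m)\<^sup>2 / ((m + c)\<^sup>2 * (g + c))"
proof -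
  have "m + c \<noteq> 0" "g + c \<noteq> 0" using assms by auto
  then show ?thesis
    by (simp add: divide_simps power2_eq_square) algebra
qed

text \<open>
  Summing the tangent identity over the slots, the linear terms add up to at most zero by the
  capacity constraint, and only the quadratic defect remains.
\<close>

lemma score_plus_defect_le:
  fixes g :: "'t::finite \<Rightarrow> real"
  assumes c: "c > 0" and g: "g \<in> feasible_allocations Gtotal k" and tot: "Gtotal k > 0"
  defines "m \<equiv> Gtotal k / real CARD('t)"
  shows "score c g + (\<Sum>t\<in>UNIV. c * (g t - m)\<^sup>2 / ((m + c)\<^sup>2 * (g t + c))) \<le> score c (\<lambda>t::'t. m)"
proof -
  have m: "m \<ge> 0" using tot by (simp add: m_def)
  have g0: "\<And>t. 0 \<le> g t" and cap: "(\<Sum>t\<in>UNIV. g t) \<le> Gtotal k"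
    using g by (auto simp: feasible_allocations_def)
  have "score c g + (\<Sum>t\<in>UNIV. c * (g t - m)\<^sup>2 / ((m + c)\<^sup>2 * (g t + c)))
      = (\<Sum>t\<in>UNIV. g t / (g t + c) + c * (g t - m)\<^sup>2 / ((m + c)\<^sup>2 * (g t + c)))"
    by (simp add: score_def sum.distrib)
  also have "\<dots> = (\<Sum>t\<in>UNIV. m / (m + c) + c / (m + c)\<^sup>2 * (g t - m))"
    by (rule sum.cong[OF refl], subst tangent_at_even_split[OF c m g0]) simp
  also have "\<dots> = score c (\<lambda>t::'t. m) + c / (m + c)\<^sup>2 * ((\<Sum>t\<in>UNIV. g t) - Gtotal k)"
    by (simp only: sum.distrib sum_distrib_left[symmetric] sum_subtractf score_def)
       (simp add: m_def)
  also have "\<dots> \<le> score c (\<lambda>t::'t. m)"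
    using cap c mult_nonneg_nonpos[of "c / (m + c)\<^sup>2" "(\<Sum>t\<in>UNIV. g t) - Gtotal k"] by simp
  finally show ?thesis .
qed

lemma defect_nonneg:
  fixes c m g :: real
  assumes "c > 0" "g \<ge> 0"
  shows "0 \<le> c * (g - m)\<^sup>2 / ((m + c)\<^sup>2 * (g + c))"
  using assms by simp

lemma score_le_even_split:
  fixes g :: "'t::finite \<Rightarrow> real"
  assumes "c > 0" "g \<in> feasible_allocations Gtotal k" "Gtotal k > 0"
  shows "score c g \<le> score c (\<lambda>t::'t. Gtotal k / real CARD('t))"
proof -
  have "0 \<le> (\<Sum>t\<in>UNIV. c * (g t - Gtotal k / real CARD('t))\<^sup>2
                 / ((Gtotal k / real CARD('t) + c)\<^sup>2 * (g t + c)))"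
    using assms by (intro sum_nonneg defect_nonneg) (auto simp: feasible_allocations_def)
  then show ?thesis using score_plus_defect_le[OF assms] by linarith
qed

text \<open>Attaining the maximal score leaves no room for any of the squares in the defect.\<close>

lemma score_even_split_unique:
  fixes g :: "'t::finite \<Rightarrow> real"
  assumes c: "c > 0" and g: "g \<in> feasible_allocations Gtotal k" and tot: "Gtotal k > 0"
    and max: "score c (\<lambda>t::'t. Gtotal k / real CARD('t)) \<le> score c g"
  shows "g = (\<lambda>t. Gtotal k / real CARD('t))"
proof
  fix t
  define m where "m = Gtotal k / real CARD('t)"
  have m: "m \<ge> 0" using tot by (simp add: m_def)
  have g0: "\<And>t. 0 \<le> g t" using g by (auto simp: feasible_allocations_def)
  define defect where "defect s = c * (g s - m)\<^sup>2 / ((m + c)\<^sup>2 * (g s + c))" for s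
  have nonneg: "\<And>s. 0 \<le> defect s"
    unfolding defect_def by (rule defect_nonneg[OF c g0])
  have "(\<Sum>s\<in>UNIV. defect s) \<le> 0"
    using score_plus_defect_le[OF c g tot] max by (simp add: defect_def m_def)
  then have "(\<Sum>s\<in>UNIV. defect s) = 0"
    using nonneg by (simp add: antisym sum_nonneg)
  then have "defect t = 0"
    using nonneg by (simp add: sum_nonneg_eq_0_iff)
  moreover have "m + c > 0" "g t + c > 0"
    using c m g0[of t] by auto
  ultimately show "g t = Gtotal k / real CARD('t)"
    using c by (simp add: defect_def m_def[symmetric])
qed

lemma even_split_feasible:
  assumes "Gtotal k > 0"
  shows "(\<lambda>t::'t::finite. Gtotal k / real CARD('t)) \<in> feasible_allocations Gtotal k"
  using assms by (simp add: feasible_allocations_def)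

lemma score_even_split_pos:
  fixes c total :: real
  assumes "c > 0" "total > 0"
  shows "0 < score c (\<lambda>t::'t::finite. total / real CARD('t))"
  using assms by (simp add: score_const zero_less_mult_iff zero_less_divide_iff add_pos_pos)

section \<open>Revenue as a proportional share of the budget\<close>

lemma revenue_eq_share:
  fixes budget :: "'n::finite \<Rightarrow> real" and G :: "'k::finite \<Rightarrow> 't::finite \<Rightarrow> real"
  assumes G0: "\<And>j t. 0 \<le> G j t"
  defines "X \<equiv> \<lambda>j. score (real CARD('n)) (G j)"
  shows "revenue budget k G = (\<Sum>n\<in>UNIV. budget n) * (X k / (X k + (\<Sum>j\<in>-{k}. X j)))"
proof -
  define c where "c = real CARD('n)"
  have c: "c > 0" by (simp add: c_def)
  have term_eq: "c / (G j h + c) = 1 - G j h / (G j h + c)" for j h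
  proof -
    have "G j h + c > 0" using c G0[of j h] by linarith
    then show ?thesis by (simp add: field_simps)
  qed
  have "real CARD('k) * real CARD('t) - (\<Sum>j\<in>UNIV. \<Sum>h\<in>UNIV. c / (G j h + c)) = (\<Sum>j\<in>UNIV. X j)"
    by (simp add: term_eq sum_subtractf X_def score_def) (simp add: c_def)
  also have "\<dots> = X k + (\<Sum>j\<in>-{k}. X j)"
    by (subst sum.remove[of _ k]) (simp_all add: Compl_eq_Diff_UNIV)
  finally have D: "real CARD('k) * real CARD('t) - (\<Sum>j\<in>UNIV. \<Sum>h\<in>UNIV. c / (G j h + c))
      = X k + (\<Sum>j\<in>-{k}. X j)" .
  show ?thesis
    unfolding revenue_def c_def[symmetric] D
    by (simp add: X_def score_def c_def sum_divide_distrib)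
qed

text \<open>The rivals' total score does not move when company \<open>k\<close> deviates.\<close>

lemma revenue_deviation:
  fixes budget :: "'n::finite \<Rightarrow> real" and G :: "'k::finite \<Rightarrow> 't::finite \<Rightarrow> real"
  assumes "\<And>j t. 0 \<le> G j t" "\<And>t. 0 \<le> g t"
  shows "revenue budget k (G(k := g)) = (\<Sum>n\<in>UNIV. budget n) *
     (score (real CARD('n)) g /
        (score (real CARD('n)) g + (\<Sum>j\<in>-{k}. score (real CARD('n)) (G j))))"
proof -
  have "(\<Sum>j\<in>-{k}. score (real CARD('n)) ((G(k := g)) j)) = (\<Sum>j\<in>-{k}. score (real CARD('n)) (G j))"
    by (rule sum.cong) auto
  then show ?thesis
    using revenue_eq_share[of "G(k := g)" budget k] assms by simp
qed

lemma share_mono: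
  fixes a b r :: real
  assumes "0 \<le> a" "a \<le> b" "0 \<le> r"
  shows "a / (a + r) \<le> b / (b + r)"
proof (cases "a = 0")
  case True
  then show ?thesis using assms by simp
next
  case False
  then have "a + r > 0" "b + r > 0" using assms by auto
  then show ?thesis using assms by (simp add: divide_simps algebra_simps mult_right_mono)
qed

lemma share_le_imp_le:
  fixes a b r :: real
  assumes "0 \<le> a" "0 \<le> b" "0 < r" "b / (b + r) \<le> a / (a + r)"
  shows "b \<le> a"
proof -
  have "a + r > 0" "b + r > 0" using assms by auto
  then show ?thesis using assms by (simp add: divide_simps algebra_simps)
qed

section \<open>Equilibria\<close>

lemma equilibrium_allocation_nonneg:
  assumes "pure_nash_equilibrium (feasible_allocations Gtotal) u G"
  shows "0 \<le> G j t"
  using assms by (auto simp: pure_nash_equilibrium_def feasible_allocations_def)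

lemma equilibrium_share_ge_even_split:
  fixes budget :: "'n::finite \<Rightarrow> real" and G :: "'k::finite \<Rightarrow> 't::finite \<Rightarrow> real"
  assumes B: "(\<Sum>n\<in>UNIV. budget n) > 0" and tot: "Gtotal k > 0"
    and NE: "pure_nash_equilibrium (feasible_allocations Gtotal) (revenue budget) G"
  defines "X \<equiv> \<lambda>j. score (real CARD('n)) (G j)"
    and "M \<equiv> score (real CARD('n)) (\<lambda>t::'t. Gtotal k / real CARD('t))"
  shows "M / (M + (\<Sum>j\<in>-{k}. X j)) \<le> X k / (X k + (\<Sum>j\<in>-{k}. X j))"
proof -
  note G0 = equilibrium_allocation_nonneg[OF NE]
  let ?e = "\<lambda>t::'t. Gtotal k / real CARD('t)"
  have "revenue budget k (G(k := ?e)) \<le> revenue budget k G"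
    using NE even_split_feasible[of Gtotal k, OF tot] by (auto simp: pure_nash_equilibrium_def)
  moreover have "\<And>t. 0 \<le> ?e t" using tot by simp
  ultimately have "(\<Sum>n\<in>UNIV. budget n) * (M / (M + (\<Sum>j\<in>-{k}. X j)))
      \<le> (\<Sum>n\<in>UNIV. budget n) * (X k / (X k + (\<Sum>j\<in>-{k}. X j)))"
    by (simp only: revenue_deviation[OF G0] revenue_eq_share[OF G0] X_def M_def)
  then show ?thesis
    using B by (rule mult_left_le_imp_le)
qed

lemma equilibrium_even_split_if_rival_scores:
  fixes budget :: "'n::finite \<Rightarrow> real" and G :: "'k::finite \<Rightarrow> 't::finite \<Rightarrow> real"
  assumes B: "(\<Sum>n\<in>UNIV. budget n) > 0" and tot: "Gtotal k > 0"
    and NE: "pure_nash_equilibrium (feasible_allocations Gtotal) (revenue budget) G"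
    and rival: "j \<noteq> k" "score (real CARD('n)) (G j) > 0"
  shows "G k = (\<lambda>t. Gtotal k / real CARD('t))"
proof (rule score_even_split_unique[where c = "real CARD('n)" and Gtotal = Gtotal and k = k])
  note G0 = equilibrium_allocation_nonneg[OF NE]
  have X0: "\<And>i. 0 \<le> score (real CARD('n)) (G i)"
    by (rule score_nonneg) (simp_all add: G0)
  have "0 < (\<Sum>i\<in>-{k}. score (real CARD('n)) (G i))"
    using rival X0 by (intro sum_pos2[of _ j]) auto
  then show "score (real CARD('n)) (\<lambda>t::'t. Gtotal k / real CARD('t)) \<le> score (real CARD('n)) (G k)"
    by (intro share_le_imp_le[OF X0 _ _ equilibrium_share_ge_even_split[where k = k, OF B tot NE]]
          score_nonneg) (use tot in simp_all)
  show "G k \<in> feasible_allocations Gtotal k"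
    using NE by (simp add: pure_nash_equilibrium_def)
qed (use tot in simp_all)

text \<open>
  If nobody scored, a company playing the even split would raise its share from \<open>0\<close> (the value
  of \<open>0 / 0\<close>) to \<open>1\<close>.
\<close>

lemma equilibrium_some_score_pos:
  fixes budget :: "'n::finite \<Rightarrow> real" and G :: "'k::finite \<Rightarrow> 't::finite \<Rightarrow> real"
  assumes B: "(\<Sum>n\<in>UNIV. budget n) > 0" and tot: "\<And>k. Gtotal k > 0"
    and NE: "pure_nash_equilibrium (feasible_allocations Gtotal) (revenue budget) G"
  shows "\<exists>j. score (real CARD('n)) (G j) > 0"
proof (rule ccontr)
  assume none: "\<not> ?thesis"
  note G0 = equilibrium_allocation_nonneg[OF NE]
  have X0: "0 \<le> score (real CARD('n)) (G i)" for i
    by (rule score_nonneg) (simp_all add: G0)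
  have zero: "score (real CARD('n)) (G i) = 0" for i
    using none X0[of i] by (meson antisym not_less)
  fix k :: 'k
  define M where "M = score (real CARD('n)) (\<lambda>t::'t. Gtotal k / real CARD('t))"
  have "M > 0"
    unfolding M_def by (rule score_even_split_pos) (simp_all add: tot)
  moreover have "M / M \<le> 0"
    using equilibrium_share_ge_even_split[where k = k, OF B tot NE] by (simp add: zero M_def)
  ultimately show False by simp
qed

lemma even_split_equilibrium:
  fixes budget :: "'n::finite \<Rightarrow> real" and Gtotal :: "'k::finite \<Rightarrow> real"
  assumes B: "(\<Sum>n\<in>UNIV. budget n) > 0" and tot: "\<And>k. Gtotal k > 0"
  shows "pure_nash_equilibrium (feasible_allocations Gtotal) (revenue budget)
           (\<lambda>k (t::'t::finite). Gtotal k / real CARD('t))"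
  unfolding pure_nash_equilibrium_def
proof (intro conjI allI ballI)
  let ?E = "\<lambda>k (t::'t). Gtotal k / real CARD('t)"
  fix k
  show "?E k \<in> feasible_allocations Gtotal k" by (rule even_split_feasible) (rule tot)
  fix g :: "'t \<Rightarrow> real"
  assume g: "g \<in> feasible_allocations Gtotal k"
  then have g0: "\<And>t. 0 \<le> g t" by (simp add: feasible_allocations_def)
  have E0: "\<And>j t. 0 \<le> ?E j t" using tot by (simp add: less_imp_le)
  show "revenue budget k (?E(k := g)) \<le> revenue budget k ?E"
    unfolding revenue_deviation[of ?E, OF E0 g0] revenue_eq_share[of ?E, OF E0]
    by (intro mult_left_mono[OF _ less_imp_le[OF B]] share_mono score_le_even_split[OF _ g tot]
          score_nonneg sum_nonneg)
       (auto simp: g0 E0)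
qed

theorem theorem3:
  fixes budget Emin :: "'n::finite \<Rightarrow> real"
    and Gtotal :: "'k::finite \<Rightarrow> real"
    and p :: "'k \<Rightarrow> 't::finite \<Rightarrow> real"
  assumes "\<And>n. budget n \<ge> 0" and "\<And>n. Emin n \<ge> 0"
    and "(\<Sum>n\<in>UNIV. budget n) > 0"
    and "\<And>k. Gtotal k > 0"
    and "\<And>k t. p k t > 0"
    and "budgets_sufficient budget Emin p"
  defines "NE \<equiv> pure_nash_equilibrium (feasible_allocations Gtotal) (revenue budget)"
    and "Gstar \<equiv> (\<lambda>(k::'k) (t::'t). Gtotal k / real CARD('t))"
  shows "NE Gstar \<and> (CARD('k) \<ge> 2 \<longrightarrow> (\<forall>G. NE G \<longrightarrow> G = Gstar))"
proof (intro conjI impI allI)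
  note B = assms(3) and tot = assms(4)
  show "NE Gstar"
    unfolding NE_def Gstar_def by (rule even_split_equilibrium[OF B tot])
  fix G
  assume K: "CARD('k) \<ge> 2" and "NE G"
  then have NE: "pure_nash_equilibrium (feasible_allocations Gtotal) (revenue budget) G"
    by (simp add: NE_def)
  note even_if_rival = equilibrium_even_split_if_rival_scores[OF B tot NE]
  obtain j where j: "score (real CARD('n)) (G j) > 0"
    using equilibrium_some_score_pos[OF B tot NE] by blast
  have "UNIV \<noteq> {j}"
  proof
    assume "UNIV = {j}"
    then have "CARD('k) = card {j}" by (rule arg_cong)
    then show False using K by simp
  qed
  then obtain i where i: "i \<noteq> j" by blast
  \<comment> \<open>Company \<open>i\<close> faces the scoring rival \<open>j\<close>, so it scores too and is in turn a scoring rival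
    for \<open>j\<close>.\<close>
  have "G i = Gstar i"
    using even_if_rival[OF i[symmetric] j] by (simp add: Gstar_def)
  then have "score (real CARD('n)) (G i) > 0"
    by (simp add: Gstar_def score_even_split_pos tot)
  then have "G j = Gstar j"
    using even_if_rival[OF i] by (simp add: Gstar_def)
  moreover have "G k = Gstar k" if "k \<noteq> j" for k
    using even_if_rival[OF that[symmetric] j] by (simp add: Gstar_def)
  ultimately show "G = Gstar" by (metis ext)
qed

end
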